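(* Consider the self-reinforced preferential attachment tree with degrees $d_t(i)$ and weights $\theta_t(i)=\sum_{s=1}^t d_s(i)$, and let $\beta_t(i)=\frac{t\,\mathbb{E}[d_t(i)]}{\mathbb{E}[\theta_t(i)]}$ for $t\ge i$, $t \geq 1$. Then, for every integer $i\ge 1$, $$\lim_{t\to\infty}\beta_t(i)=\phi,\qquad \phi=\tfrac12(1+\sqrt5).$$ Moreover, for every integer $i\ge1$ there exists a finite $T(i)\ge i$ such that $t\mapsto\beta_t(i)$ is strictly decreasing for $i\le t<T(i)$ and strictly increasing for $t\ge T(i)$.
   Context: The self-reinforced preferential attachment tree (SRPAT) is the following random growing tree. At time $0$ there is a single isolated vertex $v_0$. At time $1$ a vertex $v_1$ arrives and attaches itself to $v_0$ by a single edge. For $t\ge 1$, at time $t+1$ a vertex $v_{t+1}$ arrives and attaches itself by a single edge to exactly one of the vertices $v_0,\dots,v_t$; writing $\{t+1\to i\}$ for the event that $v_{t+1}$ attaches itself to $v_i$, the conditional probability given the history of the tree up to time $t$ is $$\mathbb{P}(t+1\to i\mid \mathcal{F}_t)=\frac{\theta_t(i)}{\sum_{j=0}^t\theta_t(j)}=\frac{\theta_t(i)}{t(t+1)},\qquad 0\le i\le t,$$ where $d_s(i)$ is the degree of $v_i$ at time $s$ (with $d_s(i)=0$ for $1\le s<i$ and $d_i(i)=1$ for $i\ge 1$; $d_1(0)=1$), $\theta_t(i)=\sum_{s=1}^t d_s(i)$, and $\mathcal{F}_t=\sigma(d_s(j):1\le s\le t,\ 0\le j\le t)$. Thus $d_{t+1}(i)=d_t(i)+\mathbb{1}_{\{t+1\to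 i\}}$ for $0\le i\le t$. $\mathbb{P}$ denotes the law of this process and $\mathbb{E}$ the corresponding expectation. Time $t$ takes integer values. *)

theory Defs
  imports "HOL-Probability.Probability"
begin

text \<open>A growing tree is encoded by its attachment map: \<open>p k\<close> is the index of the vertex
  to which vertex \<open>k \<ge> 1\<close> attaches on arrival; \<open>p 0\<close> is irrelevant.\<close>

definition tree_edges :: "(nat \<Rightarrow> nat) \<Rightarrow> nat \<Rightarrow> nat set set" where
  "tree_edges p t = (\<lambda>k. {k, p k}) ` {1..t}"

definition deg :: "(nat \<Rightarrow> nat) \<Rightarrow> nat \<Rightarrow> nat \<Rightarrow> nat" where
  "deg p t i = card {e \<in> tree_edges p t. i \<in> e}"

definition weight :: "(nat \<Rightarrow> nat) \<Rightarrow> nat \<Rightarrow> nat \<Rightarrow> nat" where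
  "weight p t i = (\<Sum>s=1..t. deg p s i)"

lemma finite_tree_edges [simp]: "finite (tree_edges p t)"
  by (simp add: tree_edges_def)

lemma tree_edges_Suc: "tree_edges p (Suc t) = insert {Suc t, p (Suc t)} (tree_edges p t)"
  by (auto simp: tree_edges_def atLeastAtMostSuc_conv)

lemma new_edge:
  assumes "\<And>k. 1 \<le> k \<Longrightarrow> p k < k" "t < i" "e \<in> tree_edges p t"
  shows "i \<notin> e"
proof -
  obtain k where k: "1 \<le> k" "k \<le> t" "e = {k, p k}"
    using assms(3) by (auto simp: tree_edges_def)
  with assms(1)[of k] assms(2) show ?thesis by auto
qed

lemma deg_before_arrival:
  assumes "\<And>k. 1 \<le> k \<Longrightarrow> p k < k" "t < i"
  shows "deg p t i = 0"
  using new_edge[of p, OF assms(1) assms(2)] by (simp add: deg_def)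

lemma deg_Suc:
  assumes "\<And>k. 1 \<le> k \<Longrightarrow> p k < k"
  shows "deg p (Suc t) i = deg p t i + of_bool (i = Suc t \<or> i = p (Suc t))"
proof -
  let ?e = "{Suc t, p (Suc t)}"
  have "?e \<notin> tree_edges p t"
    using new_edge[of p t "Suc t" ?e] assms by auto
  moreover have "{e \<in> tree_edges p (Suc t). i \<in> e} =
      (if i \<in> ?e then insert ?e {e \<in> tree_edges p t. i \<in> e} else {e \<in> tree_edges p t. i \<in> e})"
    unfolding tree_edges_Suc by auto
  ultimately show ?thesis by (simp add: deg_def)
qed

lemma deg_at_arrival:
  assumes "\<And>k. 1 \<le> k \<Longrightarrow> p k < k" "1 \<le> i"
  shows "deg p i i = 1"
proof -
  obtain j where "i = Suc j" using assms(2) by (cases i) auto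
  then show ?thesis
    using deg_Suc[of p j i, OF assms(1)] deg_before_arrival[of p j i, OF assms(1)] by simp
qed

lemma sum_deg:
  assumes "\<And>k. 1 \<le> k \<Longrightarrow> p k < k" "s \<le> t"
  shows "(\<Sum>i\<le>t. deg p s i) = 2 * s"
  using assms(2)
proof (induction s)
  case 0
  then show ?case by (simp add: deg_def tree_edges_def)
next
  case (Suc s)
  have lt: "p (Suc s) < Suc s" using assms(1) by simp
  then have "{..t} \<inter> {i. i = Suc s \<or> i = p (Suc s)} = {Suc s, p (Suc s)}"
    using Suc.prems by auto
  then have "(\<Sum>i\<le>t. of_bool (i = Suc s \<or> i = p (Suc s))) = (2::nat)"
    using lt by (simp del: of_bool_or_iff)
  then show ?case
    using Suc by (simp add: deg_Suc[of p, OF assms(1)] sum.distrib del: of_bool_or_iff)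
qed

lemma sum_weight:
  assumes "\<And>k. 1 \<le> k \<Longrightarrow> p k < k"
  shows "(\<Sum>i\<le>t. weight p t i) = t * (t + 1)"
proof -
  have "(\<Sum>i\<le>t. weight p t i) = (\<Sum>s=1..t. \<Sum>i\<le>t. deg p s i)"
    unfolding weight_def by (rule sum.swap)
  also have "\<dots> = (\<Sum>s=1..t. 2 * s)"
    using assms by (intro sum.cong) (auto simp: sum_deg)
  also have "\<dots> = t * (t + 1)"
    by (induction t) auto
  finally show ?thesis .
qed

definition history :: "'a measure \<Rightarrow> ('a \<Rightarrow> nat \<Rightarrow> nat) \<Rightarrow> nat \<Rightarrow> 'a measure" where
  "history M par t = sigma (space M)
     {{\<omega> \<in> space M. deg (par \<omega>) s j \<in> B} | s j B. 1 \<le> s \<and> s \<le> t \<and> j \<le> t}"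

text \<open>\<open>par \<omega> t\<close> is the index of the vertex to which vertex \<open>t\<close> attaches in the outcome
  \<open>\<omega>\<close>. For \<open>t = 1\<close> the condition \<open>attach_older\<close> forces attachment to vertex \<open>0\<close>.\<close>

locale srpat = prob_space M for M :: "'a measure" +
  fixes par :: "'a \<Rightarrow> nat \<Rightarrow> nat"
  assumes measurable_attach: "\<And>t. (\<lambda>\<omega>. par \<omega> t) \<in> measurable M (count_space UNIV)"
    and attach_older: "\<And>\<omega> t. \<omega> \<in> space M \<Longrightarrow> 1 \<le> t \<Longrightarrow> par \<omega> t < t"
    and attach_prob: "\<And>t i. 1 \<le> t \<Longrightarrow> i \<le> t \<Longrightarrow>
      AE \<omega> in M. real_cond_exp M (history M par t)
          (indicator {\<omega> \<in> space M. par \<omega> (t + 1) = i}) \<omega>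
        = real (weight (par \<omega>) t i) / real (\<Sum>j\<le>t. weight (par \<omega>) t j)"

definition srpat_beta :: "'a measure \<Rightarrow> ('a \<Rightarrow> nat \<Rightarrow> nat) \<Rightarrow> nat \<Rightarrow> nat \<Rightarrow> real" where
  "srpat_beta M par i t =
     real t * prob_space.expectation M (\<lambda>\<omega>. real (deg (par \<omega>) t i))
       / prob_space.expectation M (\<lambda>\<omega>. real (weight (par \<omega>) t i))"

end

theory Submission
  imports Defs
begin

text \<open>Taking expectations in the attachment rule shows that \<open>x\<^sub>t = \<beta>\<^sub>t(i)\<close> satisfies
  \<open>x\<^sub>i = i\<close> and \<open>x\<^sub>t\<^sub>+\<^sub>1 = f\<^sub>t(x\<^sub>t)\<close> for a Moebius map \<open>f\<^sub>t\<close> whose fixed points are the zeros of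
  \<open>g\<^sub>t(x) = (t + 1)(x\<^sup>2 - x - 1) + x\<close>, and \<open>x\<^sub>t\<^sub>+\<^sub>1 - x\<^sub>t\<close> has the sign of \<open>- g\<^sub>t(x\<^sub>t)\<close>. The positive zero
  of \<open>g\<^sub>t\<close> increases to the golden ratio \<open>\<phi>\<close> and \<open>f\<^sub>t\<close> is increasing, so once \<open>g\<^sub>t(x\<^sub>t) < 0\<close>
  the sequence increases forever, necessarily to \<open>\<phi>\<close>. If \<open>g\<^sub>t(x\<^sub>t) > 0\<close> held forever, then
  \<open>x\<^sub>t \<ge> \<phi>\<close> and \<open>t (x\<^sub>t - \<phi>)\<close> would decrease by at least \<open>1 / (2 (t + 1))\<close> in each step, which
  is impossible by divergence of the harmonic series. Strict monotonicity requires \<open>g\<^sub>t(x\<^sub>t) \<noteq> 0\<close>.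
  Although \<open>g\<^sub>t\<close> has rational zeros for infinitely many \<open>t\<close> (for example \<open>3/2\<close> for \<open>t = 5\<close>),
  \<open>x\<^sub>t\<close> is never one of them: \<open>x\<^sub>t\<close> is a fraction with odd denominator whose numerator has the
  parity of \<open>t\<close>, and \<open>g\<^sub>t\<close> does not vanish at such fractions modulo 2.\<close>

text \<open>Summing the decrements bounds \<open>u\<close> by a constant minus \<open>c\<close>
  times the harmonic numbers, which diverge. Both convergence arguments below end in this
  contradiction.\<close>

lemma unbounded_below_if_harmonic_decrease:
  fixes u :: "nat \<Rightarrow> real"
  assumes "c > 0" and "\<And>t. N \<le> t \<Longrightarrow> u (Suc t) \<le> u t - c / real (Suc t)"
    and "\<And>t. N \<le> t \<Longrightarrow> b \<le> u t"
  shows False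
proof -
  have *: "u (N + k) \<le> u N - c * (harm (N + k) - harm N)" for k
  proof (induction k)
    case (Suc k)
    have "harm (N + Suc k) = harm (N + k) + 1 / real (Suc (N + k))"
      by (simp add: harm_Suc inverse_eq_divide)
    then show ?case
      using Suc assms(2)[of "N + k"] by (simp add: algebra_simps)
  qed simp
  have "filterlim (harm :: nat \<Rightarrow> real) at_top sequentially"
    by (rule harm_at_top)
  then have "eventually (\<lambda>n. harm n > harm N + (u N - b) / c) sequentially"
    unfolding filterlim_at_top_dense by blast
  then obtain K where "\<And>n. K \<le> n \<Longrightarrow> harm n > harm N + (u N - b) / c"
    unfolding eventually_sequentially by blast
  then obtain n where n: "N \<le> n" "harm n > harm N + (u N - b) / c"
    using max.cobounded1[of N K] max.cobounded2[of K N] by blast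
  have "c * (harm n - harm N) > u N - b"
    using n(2) assms(1) by (simp add: field_simps)
  moreover have "u n \<le> u N - c * (harm n - harm N)"
    using *[of "n - N"] by (simp only: le_add_diff_inverse[OF n(1)])
  ultimately show False using assms(3)[OF n(1)] by simp
qed

section \<open>The recursion\<close>

definition golden :: real where "golden = (1 + sqrt 5) / 2"

definition drift :: "nat \<Rightarrow> real \<Rightarrow> real" where
  "drift t x = (real t + 1) * (x\<^sup>2 - x - 1) + x"

definition step_denom :: "nat \<Rightarrow> real \<Rightarrow> real" where
  "step_denom t x = real t * (real t + 1) + (real t + 1) * x + 1"

text \<open>With expected degree \<open>a\<close>, expected weight \<open>b\<close> and
  \<open>x = t a / b\<close>, the next ratio is \<open>(t + 1) a' / (b + a')\<close>, where
  \<open>a' = a + b / (t (t + 1))\<close>. Multiplying numerator and denominator by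
  \<open>t (t + 1) / b\<close> leaves a function of \<open>x\<close> alone.\<close>

definition step :: "nat \<Rightarrow> real \<Rightarrow> real" where
  "step t x = (real t + 1) * ((real t + 1) * x + 1) / step_denom t x"

lemma golden_bounds: "3 / 2 < golden" "golden < 2"
proof -
  have "2 < sqrt 5" "sqrt 5 < 3" by (auto intro: real_less_rsqrt real_less_lsqrt)
  then show "3 / 2 < golden" "golden < 2" by (auto simp: golden_def)
qed

lemma golden_square: "golden\<^sup>2 = golden + 1"
  by (simp add: golden_def power2_eq_square field_simps)

lemma golden_factor: "x\<^sup>2 - x - 1 = (x - golden) * (x + golden - 1)"
  using golden_square by (simp add: algebra_simps power2_eq_square)

lemma step_denom_pos: "0 < x \<Longrightarrow> 0 < step_denom t x"
  by (simp add: step_denom_def add_nonneg_pos)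

lemma step_pos: "0 < x \<Longrightarrow> 0 < step t x"
  using step_denom_pos[of x t] by (simp add: step_def add_pos_pos)

lemma step_diff:
  assumes "0 < x"
  shows "step t x = x - drift t x / step_denom t x"
proof -
  have "step_denom t x \<noteq> 0" using step_denom_pos[OF assms, of t] by simp
  then show ?thesis
    by (simp add: step_def drift_def field_simps)
      (simp add: step_denom_def algebra_simps power2_eq_square)
qed

text \<open>A Moebius map multiplies the quadratic form of its fixed points by its determinant.\<close>

lemma drift_step:
  assumes "0 < x"
  shows "drift t (step t x) * (step_denom t x)\<^sup>2 = real t * (real t + 1) ^ 3 * drift t x"
proof -
  define D where "D = step_denom t x"
  define n where "n = (real t + 1) * ((real t + 1) * x + 1)"
  have D: "D \<noteq> 0" using step_denom_pos[OF assms, of t] by (simp add: D_def)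
  have "drift t (n / D) * D\<^sup>2 = (real t + 1) * (n\<^sup>2 - n * D - D\<^sup>2) + n * D"
    using D by (simp add: drift_def field_simps power2_eq_square)
  also have "\<dots> = real t * (real t + 1) ^ 3 * drift t x"
    unfolding n_def D_def step_denom_def drift_def by algebra
  finally show ?thesis by (simp add: step_def n_def D_def)
qed

text \<open>For positive \<open>x\<close> a negative drift forces
  \<open>x\<^sup>2 - x - 1 < 0\<close>, whose only positive root is \<open>golden\<close>.\<close>

lemma drift_neg_less_golden:
  assumes "0 < x" "drift t x < 0"
  shows "x < golden"
proof -
  have "(real t + 1) * (x\<^sup>2 - x - 1) < 0" using assms by (simp add: drift_def)
  then have "(x - golden) * (x + golden - 1) < 0"
    by (simp add: golden_factor mult_less_0_iff)
  then show ?thesis using assms(1) golden_bounds by (simp add: mult_less_0_iff)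
qed

text \<open>The determinant in \<open>drift_step\<close> is positive, so \<open>step t x\<close>
  still has negative \<open>drift t\<close> and lies below \<open>golden\<close>. Raising the index
  to \<open>Suc t\<close> adds \<open>y\<^sup>2 - y - 1\<close> at \<open>y = step t x\<close>,
  which is then negative too.\<close>

lemma drift_neg_step:
  assumes "0 < x" "drift t x < 0" "1 \<le> t"
  shows "drift (Suc t) (step t x) < 0"
proof -
  have pos: "0 < step t x" using assms(1) by (rule step_pos)
  have "drift t (step t x) * (step_denom t x)\<^sup>2 < 0"
    using assms by (simp add: drift_step mult_pos_neg)
  then have neg: "drift t (step t x) < 0" by (simp add: mult_less_0_iff)
  have "(step t x - golden) * (step t x + golden - 1) < 0"
    using drift_neg_less_golden[OF pos neg] pos golden_bounds by (intro mult_neg_pos) auto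
  then have "(step t x)\<^sup>2 - step t x - 1 < 0" by (simp only: golden_factor)
  with neg show ?thesis by (simp add: drift_def algebra_simps)
qed

text \<open>Reduction modulo 2 of the equation \<open>drift t (n / d) = 0\<close>.\<close>

lemma drift_nonzero:
  fixes n d :: int
  assumes "odd d" "even (n - int t)"
  shows "drift t (of_int n / of_int d) \<noteq> 0"
proof
  assume "drift t (of_int n / of_int d) = 0"
  moreover have "d \<noteq> 0" using assms(1) by auto
  ultimately have "(real t + 1) * (of_int n ^ 2 - of_int n * of_int d - of_int d ^ 2) + of_int n * of_int d = 0"
    by (simp add: drift_def field_simps power2_eq_square)
  then have "real_of_int ((int t + 1) * (n\<^sup>2 - n * d - d\<^sup>2) + n * d) = 0"
    by simp
  then have "(int t + 1) * (n\<^sup>2 - n * d - d\<^sup>2) + n * d = 0"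
    by (simp only: of_int_eq_0_iff)
  then have "even ((int t + 1) * (n\<^sup>2 - n * d - d\<^sup>2) + n * d)" by simp
  with assms show False by (auto simp: power2_eq_square)
qed

section \<open>Turning point and limit of the recursive sequence\<close>

locale golden_recursion =
  fixes x :: "nat \<Rightarrow> real" and i :: nat
  assumes i_ge_1: "1 \<le> i"
    and x_start: "x i = real i"
    and x_Suc: "\<And>t. i \<le> t \<Longrightarrow> x (Suc t) = step t (x t)"
begin

lemma x_pos: "i \<le> t \<Longrightarrow> 0 < x t"
  by (induction t rule: dec_induct) (use i_ge_1 in \<open>auto simp: x_start x_Suc step_pos\<close>)

text \<open>The fractions need not be reduced: the parities are carried along by the unsimplified
  numerator and denominator of \<open>step\<close>. Modulo 2 the product \<open>(t + 1) n\<close>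
  vanishes, so the new denominator is congruent to \<open>d\<close>.\<close>

lemma x_parity:
  assumes "i \<le> t"
  shows "\<exists>n d. odd d \<and> even (n - int t) \<and> x t = of_int n / of_int d"
  using assms
proof (induction t rule: dec_induct)
  case base
  show ?case by (rule exI[of _ "int i"], rule exI[of _ 1]) (simp add: x_start)
next
  case (step t)
  then obtain n d where nd: "odd d" "even (n - int t)" "x t = of_int n / of_int d" by auto
  define n' where "n' = (int t + 1) * ((int t + 1) * n + d)"
  define d' where "d' = int t * (int t + 1) * d + (int t + 1) * n + d"
  have "odd d'" "even (n' - int (Suc t))" using nd by (auto simp: n'_def d'_def)
  moreover have "x (Suc t) = of_int n' / of_int d'"
  proof -
    have d: "real_of_int d \<noteq> 0" using nd(1) by auto
    have "step_denom t (x t) = of_int d' / of_int d"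
      using d by (simp add: step_denom_def nd d'_def field_simps)
    moreover have "(real t + 1) * ((real t + 1) * x t + 1) = of_int n' / of_int d"
      using d by (simp add: nd n'_def field_simps)
    ultimately show ?thesis using d step.hyps(1) by (simp add: x_Suc step_def)
  qed
  ultimately show ?case by blast
qed

lemma drift_x_nonzero: "i \<le> t \<Longrightarrow> drift t (x t) \<noteq> 0"
  using x_parity[of t] drift_nonzero by force

lemma x_diff: "i \<le> t \<Longrightarrow> x (Suc t) = x t - drift t (x t) / step_denom t (x t)"
  by (simp add: x_Suc step_diff x_pos)

lemma x_increases_iff: "i \<le> t \<Longrightarrow> x t < x (Suc t) \<longleftrightarrow> drift t (x t) < 0"
  using step_denom_pos[OF x_pos, of t t] by (simp add: x_diff divide_less_0_iff)

lemma x_decreases_iff: "i \<le> t \<Longrightarrow> x (Suc t) < x t \<longleftrightarrow> drift t (x t) > 0"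
  using step_denom_pos[OF x_pos, of t t] by (simp add: x_diff zero_less_divide_iff)

lemma drift_neg_persists:
  assumes "i \<le> s" "drift s (x s) < 0" "s \<le> t"
  shows "drift t (x t) < 0"
  using assms(3)
proof (induction t rule: dec_induct)
  case base
  show ?case by (rule assms)
next
  case (step t)
  then show ?case
    using drift_neg_step[of "x t" t] assms(1) i_ge_1 by (simp add: x_Suc x_pos)
qed

lemma drift_eventually_neg: "\<exists>t\<ge>i. drift t (x t) < 0"
proof (rule ccontr)
  assume "\<not> ?thesis"
  then have pos: "drift t (x t) > 0" if "i \<le> t" for t
    using that drift_x_nonzero[of t] by force
  have dec: "x t \<le> x s" if "i \<le> s" "s \<le> t" for s t
    using that(2)
  proof (induction t rule: dec_induct)
    case (step t)
    with that(1) show ?case using x_decreases_iff[of t] pos[of t] by auto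
  qed simp
  \<comment> \<open>A non-increasing sequence that once lies below \<open>golden\<close> by
    \<open>e\<close> stays that far below, and then the term with factor \<open>t + 1\<close>
    eventually makes the drift negative.\<close>
  have ge: "golden \<le> x s" if s: "i \<le> s" for s
  proof (rule ccontr)
    assume less: "\<not> golden \<le> x s"
    define e where "e = golden - x s"
    have e: "0 < e" using less by (simp add: e_def)
    obtain k :: nat where k: "golden / (e * (1/2)) < real k" using reals_Archimedean2 by blast
    define t where "t = max s k"
    have t: "s \<le> t" "i \<le> t" "real k \<le> real t" using s by (auto simp: t_def)
    have xt: "0 < x t" "x t \<le> golden - e" using x_pos t dec[OF s t(1)] by (auto simp: e_def)
    \<comment> \<open>The factor 1/2 is a lower bound for \<open>golden - 1\<close>.\<close>
    have "e * (1/2) \<le> (golden - x t) * (x t + golden - 1)"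
      using xt golden_bounds e by (intro mult_mono) auto
    then have "(real t + 1) * (e * (1/2)) \<le> (real t + 1) * ((golden - x t) * (x t + golden - 1))"
      by (intro mult_left_mono) auto
    moreover have "golden < (real t + 1) * (e * (1/2))"
    proof -
      have "golden < real k * (e * (1/2))" using k e by (simp add: field_simps)
      also have "\<dots> \<le> (real t + 1) * (e * (1/2))" using t e by (intro mult_right_mono) auto
      finally show ?thesis .
    qed
    moreover have "drift t (x t) = x t - (real t + 1) * ((golden - x t) * (x t + golden - 1))"
      unfolding drift_def golden_factor by (simp add: algebra_simps)
    ultimately show False using pos[OF t(2)] xt e by linarith
  qed
  \<comment> \<open>The weight \<open>t\<close> is chosen to absorb the linear decay: the part
    \<open>2 (t + 1) y\<close> of the drift lowers \<open>y\<close> by at least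
    \<open>y / (t + 1)\<close>, which offsets the growth of the weight from \<open>t\<close> to
    \<open>t + 1\<close>. The remaining 1 in the drift bound yields the harmonic term.\<close>
  define z where "z t = real t * (x t - golden)" for t
  have "z (Suc t) \<le> z t - (1/2) / real (Suc t)" if t: "i \<le> t" for t
  proof -
    define D where "D = step_denom t (x t)"
    define y where "y = x t - golden"
    have D: "0 < D" using t by (simp add: D_def step_denom_pos x_pos)
    have y: "0 \<le> y" using ge t by (simp add: y_def)
    \<comment> \<open>The sequence starts at \<open>i\<close> and does not increase; this makes the
      denominator at most quadratic in \<open>t + 1\<close>.\<close>
    have "x t \<le> real t" using dec[of i t] t by (simp add: x_start)
    then have "(real t + 1) * x t \<le> (real t + 1) * real t" by (intro mult_left_mono) auto
    then have D_le: "D \<le> 2 * (real t + 1)\<^sup>2"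
      by (simp add: D_def step_denom_def power2_eq_square algebra_simps)
    have x: "x t = y + golden" by (simp add: y_def)
    have "2 * y \<le> y * (y + (2 * golden - 1))"
      using y golden_bounds by (subst mult.commute, intro mult_left_mono) auto
    then have "2 * y \<le> (x t)\<^sup>2 - x t - 1"
      unfolding golden_factor by (simp add: x algebra_simps)
    then have "(real t + 1) * (2 * y) \<le> (real t + 1) * ((x t)\<^sup>2 - x t - 1)"
      by (intro mult_left_mono) auto
    moreover have "1 \<le> x t" using x y golden_bounds by linarith
    ultimately have drift_ge: "2 * (real t + 1) * y + 1 \<le> drift t (x t)"
      unfolding drift_def by linarith
    have "(y + 1 / (2 * (real t + 1))) / (real t + 1) = (2 * (real t + 1) * y + 1) / (2 * (real t + 1)\<^sup>2)"
      by (simp add: field_simps power2_eq_square)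
    also have "\<dots> \<le> (2 * (real t + 1) * y + 1) / D"
      using D D_le y by (intro divide_left_mono) auto
    also have "\<dots> \<le> drift t (x t) / D" using drift_ge D by (intro divide_right_mono) auto
    finally have "(y + 1 / (2 * (real t + 1))) \<le> (real t + 1) * (drift t (x t) / D)"
      by (simp add: pos_divide_le_eq mult.commute)
    then have "(real t + 1) * (y - drift t (x t) / D) \<le> (real t + 1) * y - (y + 1 / (2 * (real t + 1)))"
      by (simp add: right_diff_distrib)
    moreover have "z (Suc t) = (real t + 1) * (y - drift t (x t) / D)"
      using t by (simp add: z_def x_diff y_def D_def algebra_simps)
    ultimately show ?thesis by (simp add: z_def y_def algebra_simps)
  qed
  moreover have "0 \<le> z t" if "i \<le> t" for t using ge[OF that] by (simp add: z_def)
  ultimately show False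
    using unbounded_below_if_harmonic_decrease[of "1/2" i z 0] by simp
qed

text \<open>The turning point is the first time of negative drift: earlier drifts are positive
  because they never vanish, and later ones remain negative.\<close>

lemma ex_turning_point:
  "\<exists>T\<ge>i. (\<forall>t. i \<le> t \<and> t < T \<longrightarrow> x (Suc t) < x t) \<and> (\<forall>t\<ge>T. x t < x (Suc t))"
proof -
  define T where "T = (LEAST t. i \<le> t \<and> drift t (x t) < 0)"
  have T: "i \<le> T" "drift T (x T) < 0"
    using LeastI_ex[OF drift_eventually_neg[unfolded Bex_def]] by (auto simp: T_def)
  have "x (Suc t) < x t" if "i \<le> t" "t < T" for t
    using not_less_Least[of t "\<lambda>t. i \<le> t \<and> drift t (x t) < 0"] that drift_x_nonzero[of t]
    by (auto simp: T_def x_decreases_iff)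
  moreover have "x t < x (Suc t)" if "T \<le> t" for t
    using drift_neg_persists[OF T that] T(1) that by (simp add: x_increases_iff)
  ultimately show ?thesis using T(1) by blast
qed

lemma x_tendsto_golden: "x \<longlonglongrightarrow> golden"
proof -
  obtain T where T: "i \<le> T" "drift T (x T) < 0" using drift_eventually_neg by blast
  have neg: "drift t (x t) < 0" if "T \<le> t" for t using drift_neg_persists[OF T that] .
  have less: "x t < golden" if "T \<le> t" for t
    using drift_neg_less_golden[OF x_pos neg[OF that]] that T(1) by simp
  have inc: "x s \<le> x t" if "T \<le> s" "s \<le> t" for s t
    using that(2)
  proof (induction t rule: dec_induct)
    case (step t)
    with that(1) T(1) show ?case using x_increases_iff[of t] neg[of t] by auto
  qed simp
  show ?thesis
  proof (rule order_tendstoI)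
    fix a assume "golden < a"
    then show "eventually (\<lambda>t. x t < a) sequentially"
      using less by (intro eventually_sequentiallyI[of T]) force
  next
    fix a assume a: "a < golden"
    \<comment> \<open>Staying below \<open>a\<close> would keep the drift below a negative multiple
      of \<open>t + 1\<close>, while the denominator is at most \<open>2 (t + 1)\<^sup>2\<close>.
      The increments would then be at least harmonic, contradicting the bound
      \<open>golden\<close>.\<close>
    have "\<exists>s\<ge>T. a < x s"
    proof (rule ccontr)
      assume "\<not> ?thesis"
      then have le: "x t \<le> a" if "T \<le> t" for t using that by force
      define e where "e = golden - a"
      have e: "0 < e" using a by (simp add: e_def)
      obtain k :: nat where k: "golden / (e / 4) < real k" using reals_Archimedean2 by blast
      \<comment> \<open>Beyond \<open>k\<close> half of the main term \<open>(t + 1) e / 2\<close>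
        outweighs \<open>golden\<close>; the 2 ensures \<open>x t < golden < 2 \<le> t\<close>,
        needed to bound the denominator.\<close>
      define N where "N = max T (max k 2)"
      have "- x (Suc t) \<le> - x t - (e / 8) / real (Suc t)" if "N \<le> t" for t
      proof -
        have t: "T \<le> t" "i \<le> t" "k \<le> t" "2 \<le> t" using that T(1) by (auto simp: N_def)
        define D where "D = step_denom t (x t)"
        have D: "0 < D" using t by (simp add: D_def step_denom_pos x_pos)
        have xt: "0 < x t" "x t \<le> golden - e" "x t < real t"
          using x_pos t le[of t] less[of t] golden_bounds by (auto simp: e_def)
        have "(real t + 1) * x t \<le> (real t + 1) * real t" using xt by (intro mult_left_mono) auto
        then have D_le: "D \<le> 2 * (real t + 1)\<^sup>2"
          by (simp add: D_def step_denom_def power2_eq_square algebra_simps)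
        have "e * (1/2) \<le> (golden - x t) * (x t + golden - 1)"
          using xt golden_bounds e by (intro mult_mono) auto
        then have "(real t + 1) * (e * (1/2)) \<le> (real t + 1) * ((golden - x t) * (x t + golden - 1))"
          by (intro mult_left_mono) auto
        moreover have "golden < (real t + 1) * (e / 4)"
        proof -
          have "golden < real k * (e / 4)" using k e by (simp add: field_simps)
          also have "\<dots> \<le> (real t + 1) * (e / 4)" using t e by (intro mult_right_mono) auto
          finally show ?thesis .
        qed
        moreover have "- drift t (x t) = (real t + 1) * ((golden - x t) * (x t + golden - 1)) - x t"
          unfolding drift_def golden_factor by (simp add: algebra_simps)
        ultimately have drift: "(real t + 1) * (e / 4) \<le> - drift t (x t)"
          using xt e by (simp add: field_simps)
        have "e / 8 / s = s * (e / 4) / (2 * s\<^sup>2)" if "s \<noteq> 0" for s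
          using that by (simp add: power2_eq_square)
        from this[of "real t + 1"]
        have "(e / 8) / real (Suc t) = (real t + 1) * (e / 4) / (2 * (real t + 1)\<^sup>2)"
          by (simp add: add.commute)
        also have "\<dots> \<le> (real t + 1) * (e / 4) / D"
          using D D_le e by (intro divide_left_mono) auto
        also have "\<dots> \<le> - drift t (x t) / D" using drift D by (intro divide_right_mono) auto
        finally show ?thesis using t by (simp add: x_diff D_def)
      qed
      moreover have "- golden \<le> - x t" if "N \<le> t" for t
        using less[of t] that by (simp add: N_def)
      ultimately show False
        using unbounded_below_if_harmonic_decrease[of "e / 8" N "\<lambda>t. - x t" "- golden"] e by simp
    qed
    then obtain s where s: "T \<le> s" "a < x s" by blast
    show "eventually (\<lambda>t. a < x t) sequentially"
      using inc[OF s(1)] s(2) by (intro eventually_sequentiallyI[of s]) force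
  qed
qed

end

section \<open>Expected degrees and weights\<close>

lemma deg_le: "deg p t j \<le> t"
proof -
  have "deg p t j \<le> card (tree_edges p t)" unfolding deg_def by (intro card_mono) auto
  also have "\<dots> \<le> t" unfolding tree_edges_def using card_image_le[of "{1..t}"] by simp
  finally show ?thesis .
qed

context srpat
begin

lemma measurable_deg: "(\<lambda>\<omega>. deg (par \<omega>) t j) \<in> measurable M (count_space UNIV)"
proof (induction t)
  case 0
  show ?case by (simp add: deg_def tree_edges_def)
next
  case (Suc t)
  note [measurable] = Suc measurable_attach
  have "(\<lambda>\<omega>. deg (par \<omega>) t j + of_bool (j = Suc t \<or> j = par \<omega> (Suc t)))
      \<in> measurable M (count_space UNIV)"
    by measurable
  moreover have "deg (par \<omega>) (Suc t) j = deg (par \<omega>) t j + of_bool (j = Suc t \<or> j = par \<omega> (Suc t))"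
    if "\<omega> \<in> space M" for \<omega>
    using deg_Suc[of "par \<omega>" t j] attach_older[OF that] by blast
  ultimately show ?case by (simp cong: measurable_cong)
qed

lemma attach_event: "{\<omega> \<in> space M. par \<omega> t = j} \<in> events"
  using measurable_sets[OF measurable_attach[of t], of "{j}"]
  by (simp add: vimage_def Int_def conj_commute)

lemma integrable_deg: "integrable M (\<lambda>\<omega>. real (deg (par \<omega>) t j))"
  by (rule integrable_const_bound[of _ "real t"])
    (auto simp: deg_le intro: measurable_compose[OF measurable_deg])

lemma integrable_weight: "integrable M (\<lambda>\<omega>. real (weight (par \<omega>) t j))"
  by (simp add: weight_def integrable_deg)

lemma subalgebra_history: "subalgebra M (history M par t)"
proof -
  let ?G = "{{\<omega> \<in> space M. deg (par \<omega>) s j \<in> B} | s j B. 1 \<le> s \<and> s \<le> t \<and> j \<le> t}"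
  have "{\<omega> \<in> space M. deg (par \<omega>) s j \<in> B} \<in> sets M" for s j B
    using measurable_sets[OF measurable_deg[of s j], of B] by (simp add: vimage_def Int_def conj_commute)
  then have "?G \<subseteq> sets M" by auto
  then have "sigma_sets (space M) ?G \<subseteq> sets M" by (rule sets.sigma_sets_subset)
  moreover have "?G \<subseteq> Pow (space M)" by auto
  ultimately show ?thesis by (simp add: subalgebra_def history_def)
qed

text \<open>Integrating the conditional probability suffices because the total weight is
  deterministic, so no expectation of a random quotient arises.\<close>

lemma prob_attach:
  assumes "1 \<le> t" "j \<le> t"
  shows "prob {\<omega> \<in> space M. par \<omega> (Suc t) = j}
    = expectation (\<lambda>\<omega>. real (weight (par \<omega>) t j)) / (real t * (real t + 1))"
proof -
  interpret finite_measure_subalgebra M "history M par t"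
    by unfold_locales (rule subalgebra_history)
  let ?A = "{\<omega> \<in> space M. par \<omega> (Suc t) = j}"
  note A = attach_event[of "Suc t" j]
  have "prob ?A = expectation (indicator ?A)" using A by simp
  also have "\<dots> = expectation (real_cond_exp M (history M par t) (indicator ?A))"
    by (rule real_cond_exp_int(2)[symmetric], rule integrable_real_indicator)
      (use A in \<open>auto simp: less_top[symmetric]\<close>)
  also have "\<dots> = expectation (\<lambda>\<omega>. real (weight (par \<omega>) t j) / (real t * (real t + 1)))"
  proof (rule integral_cong_AE)
    have "AE \<omega> in M. real (\<Sum>k\<le>t. weight (par \<omega>) t k) = real t * (real t + 1)"
    proof (rule AE_I2)
      fix \<omega> assume "\<omega> \<in> space M"
      then show "real (\<Sum>k\<le>t. weight (par \<omega>) t k) = real t * (real t + 1)"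
        using sum_weight[of "par \<omega>" t] attach_older by (simp del: of_nat_sum add: algebra_simps)
    qed
    then show "AE \<omega> in M. real_cond_exp M (history M par t) (indicator ?A) \<omega>
        = real (weight (par \<omega>) t j) / (real t * (real t + 1))"
      using attach_prob[OF assms] by eventually_elim simp
  qed (use integrable_weight[of t j] in auto)
  also have "\<dots> = expectation (\<lambda>\<omega>. real (weight (par \<omega>) t j)) / (real t * (real t + 1))"
    by simp
  finally show ?thesis .
qed

lemma expectation_deg_Suc:
  assumes "1 \<le> t" "j \<le> t"
  shows "expectation (\<lambda>\<omega>. real (deg (par \<omega>) (Suc t) j)) = expectation (\<lambda>\<omega>. real (deg (par \<omega>) t j))
    + expectation (\<lambda>\<omega>. real (weight (par \<omega>) t j)) / (real t * (real t + 1))"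
proof -
  let ?A = "{\<omega> \<in> space M. par \<omega> (Suc t) = j}"
  note A = attach_event[of "Suc t" j]
  have "expectation (\<lambda>\<omega>. real (deg (par \<omega>) (Suc t) j))
      = expectation (\<lambda>\<omega>. real (deg (par \<omega>) t j) + indicator ?A \<omega>)"
  proof (rule Bochner_Integration.integral_cong)
    fix \<omega> assume "\<omega> \<in> space M"
    then show "real (deg (par \<omega>) (Suc t) j) = real (deg (par \<omega>) t j) + indicator ?A \<omega>"
      using deg_Suc[of "par \<omega>" t j] attach_older assms by (auto simp: indicator_def)
  qed simp
  also have "\<dots> = expectation (\<lambda>\<omega>. real (deg (par \<omega>) t j)) + prob ?A"
    using A by (subst Bochner_Integration.integral_add)
      (auto simp: integrable_deg less_top[symmetric] intro!: integrable_real_indicator)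
  finally show ?thesis by (simp add: prob_attach[OF assms])
qed

lemma expectation_weight_Suc:
  "expectation (\<lambda>\<omega>. real (weight (par \<omega>) (Suc t) j))
    = expectation (\<lambda>\<omega>. real (weight (par \<omega>) t j)) + expectation (\<lambda>\<omega>. real (deg (par \<omega>) (Suc t) j))"
proof -
  have "real (weight (par \<omega>) (Suc t) j) = real (weight (par \<omega>) t j) + real (deg (par \<omega>) (Suc t) j)" for \<omega>
    by (simp add: weight_def)
  then show ?thesis by (simp add: integrable_deg integrable_weight)
qed

lemma expectation_at_arrival:
  assumes "1 \<le> j"
  shows "expectation (\<lambda>\<omega>. real (deg (par \<omega>) j j)) = 1"
    and "expectation (\<lambda>\<omega>. real (weight (par \<omega>) j j)) = 1"
proof -
  have d: "deg (par \<omega>) j j = 1" if "\<omega> \<in> space M" for \<omega>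
    using deg_at_arrival[of "par \<omega>" j] attach_older[OF that] assms by blast
  have w: "weight (par \<omega>) j j = 1" if "\<omega> \<in> space M" for \<omega>
  proof -
    \<comment> \<open>All degrees before arrival are zero, so only the summand at time
      \<open>j\<close> survives.\<close>
    have "weight (par \<omega>) j j = (\<Sum>s\<in>{j}. deg (par \<omega>) s j)"
      unfolding weight_def using assms deg_before_arrival[of "par \<omega>" _ j] attach_older[OF that]
      by (intro sum.mono_neutral_right) auto
    then show ?thesis using d[OF that] by simp
  qed
  show "expectation (\<lambda>\<omega>. real (deg (par \<omega>) j j)) = 1"
    "expectation (\<lambda>\<omega>. real (weight (par \<omega>) j j)) = 1"
    using d w by (simp_all add: prob_space cong: Bochner_Integration.integral_cong)
qed

lemma expectation_weight_pos:
  assumes "1 \<le> j" "j \<le> t"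
  shows "0 < expectation (\<lambda>\<omega>. real (weight (par \<omega>) t j))"
  using assms(2)
proof (induction t rule: dec_induct)
  case base
  show ?case by (simp add: expectation_at_arrival[OF assms(1)])
next
  case (step t)
  then show ?case by (simp add: expectation_weight_Suc add_pos_nonneg)
qed

lemma golden_recursion_beta:
  assumes "1 \<le> i"
  shows "golden_recursion (srpat_beta M par i) i"
proof
  show "srpat_beta M par i i = real i"
    by (simp add: srpat_beta_def expectation_at_arrival[OF assms])
  fix t assume t: "i \<le> t"
  define a where "a = expectation (\<lambda>\<omega>. real (deg (par \<omega>) t i))"
  define b where "b = expectation (\<lambda>\<omega>. real (weight (par \<omega>) t i))"
  have a: "0 \<le> a" by (simp add: a_def)
  have b: "0 < b" using expectation_weight_pos[OF assms t] by (simp add: b_def)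
  have t0: "0 < real t" using assms t by simp
  define a' where "a' = a + b / (real t * (real t + 1))"
  have beta: "srpat_beta M par i t = real t * a / b"
    by (simp add: srpat_beta_def a_def b_def)
  have "srpat_beta M par i (Suc t) = (real t + 1) * a' / (b + a')"
    using expectation_deg_Suc[of t i] assms t
    by (simp add: srpat_beta_def expectation_weight_Suc a_def b_def a'_def add.commute)
  also have "\<dots> = step t (real t * a / b)"
  proof -
    define s where "s = real t + 1"
    \<comment> \<open>The common factor that clears the denominators and brings the quotient into
      the form of \<open>step\<close>.\<close>
    define c where "c = real t * s / b"
    have s: "0 < s" by (simp add: s_def)
    have c: "c \<noteq> 0" using t0 b s by (simp add: c_def)
    have "c * a' = s * (real t * a / b) + 1"
      using t0 b s unfolding c_def a'_def s_def[symmetric] by (simp add: field_simps)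
    moreover have "c * b = real t * s" using b by (simp add: c_def)
    ultimately have "step_denom t (real t * a / b) = c * (b + a')"
      and "s * (s * (real t * a / b) + 1) = c * (s * a')"
      unfolding step_denom_def s_def[symmetric] by algebra+
    then show ?thesis using c by (simp add: step_def s_def)
  qed
  finally show "srpat_beta M par i (Suc t) = step t (srpat_beta M par i t)" by (simp add: beta)
qed (rule assms)

end

theorem theorem2:
  fixes M :: "'a measure" and par :: "'a \<Rightarrow> nat \<Rightarrow> nat" and i :: nat
  assumes "srpat M par" and "1 \<le> i"
  shows "(\<lambda>t. srpat_beta M par i t) \<longlonglongrightarrow> (1 + sqrt 5) / 2
    \<and> (\<exists>T::nat. i \<le> T
        \<and> (\<forall>t. i \<le> t \<and> t < T \<longrightarrow> srpat_beta M par i (t + 1) < srpat_beta M par i t)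
        \<and> (\<forall>t. T \<le> t \<longrightarrow> srpat_beta M par i t < srpat_beta M par i (t + 1)))"
proof -
  interpret golden_recursion "srpat_beta M par i" i
    using srpat.golden_recursion_beta[OF assms] .
  show ?thesis using x_tendsto_golden ex_turning_point by (simp add: golden_def)
qed

end
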